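(* Let $L$ be a first-order language, let $\Gamma$ be a finite set of countable unary $L$-types, and let $M$ be an $L$-structure that omits every type in $\Gamma$ and is $\Gamma$-nice. Then either (a) every $L$-structure that omits every type in $\Gamma$ and is elementarily equivalent to $M$ is isomorphic to $M$; or (b) there are elementary extensions $N\succeq M$ of all sizes.
   Context: A unary $L$-type is a set of $L$-formulas in one free variable $x$; a structure omits it if no element satisfies all its formulas. A choice function on $\Gamma$ is a map $\mathcal{C}$ assigning to each $p\in\Gamma$ a formula $\mathcal{C}(p)\in p$. An element $a\in M$ is witnessed by $\mathcal{C}$ if $M\models\neg\mathcal{C}(p)(a)$ for every $p\in\Gamma$. The structure $M$ is $\Gamma$-nice if for every $L$-formula of the form $\psi(y_1,\dots,y_n)\equiv\exists x\,\phi(x,y_1,\dots,y_n)$ there is a map $g_\psi$ taking $n$-tuples of choice functions on $\Gamma$ to a choice function on $\Gamma$ such that whenever $b_1,\dots,b_n\in M$ are witnessed by $\mathcal{C}_1,\dots,\mathcal{C}_n$ and $M\models\exists x\,\phi(x,b_1,\dots,b_n)$, there is $m\in M$ with $M\models\phi(m,b_1,\dots,b_n)\wedge\neg\chi(m)$ for every $p\in\Gamma$, where $\chi=g_\psi(\mathcal{C}_1,\dots,\mathcal{C}_n)(p)$. *)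

theory Defs
  imports Main "HOL-Library.FuncSet" "HOL-Library.Countable_Set" "HOL-Library.Equipollence"
begin

text \<open>
  First-order logic with equality. The symbols of a language form sets, so that either sort of
  symbol may be absent; constants are function symbols of arity 0. Variables are de Bruijn
  indices: a formula \<open>\<phi>(x\<^sub>0, \<dots>, x\<^sub>n\<^sub>-\<^sub>1)\<close> is one whose free indices are less than \<open>n\<close>, and it is
  evaluated at a list of length \<open>n\<close>. In \<open>Ex \<phi>\<close> the bound variable is index 0 of \<open>\<phi>\<close>, so that
  \<open>\<exists>x. \<phi>(x, y\<^sub>1, \<dots>, y\<^sub>n)\<close> is \<open>Ex \<phi>\<close> with \<open>\<phi>\<close> evaluated at \<open>[x, y\<^sub>1, \<dots>, y\<^sub>n]\<close>.
\<close>

record ('f, 'r) language =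
  Funs :: "'f set"
  Rels :: "'r set"
  fun_arity :: "'f \<Rightarrow> nat"
  rel_arity :: "'r \<Rightarrow> nat"

datatype 'f tm = Var nat | App 'f "'f tm list"

datatype ('f, 'r) fm =
    Eq "'f tm" "'f tm"
  | Rel 'r "'f tm list"
  | Neg "('f, 'r) fm"
  | Conj "('f, 'r) fm" "('f, 'r) fm"
  | Ex "('f, 'r) fm"

primrec wf_tm :: "('f, 'r) language \<Rightarrow> nat \<Rightarrow> 'f tm \<Rightarrow> bool" where
  "wf_tm L n (Var i) \<longleftrightarrow> i < n"
| "wf_tm L n (App f ts) \<longleftrightarrow>
     f \<in> Funs L \<and> length ts = fun_arity L f \<and> list_all (wf_tm L n) ts"

primrec wf_fm :: "('f, 'r) language \<Rightarrow> nat \<Rightarrow> ('f, 'r) fm \<Rightarrow> bool" where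
  "wf_fm L n (Eq s t) \<longleftrightarrow> wf_tm L n s \<and> wf_tm L n t"
| "wf_fm L n (Rel r ts) \<longleftrightarrow>
     r \<in> Rels L \<and> length ts = rel_arity L r \<and> list_all (wf_tm L n) ts"
| "wf_fm L n (Neg \<phi>) \<longleftrightarrow> wf_fm L n \<phi>"
| "wf_fm L n (Conj \<phi> \<psi>) \<longleftrightarrow> wf_fm L n \<phi> \<and> wf_fm L n \<psi>"
| "wf_fm L n (Ex \<phi>) \<longleftrightarrow> wf_fm L (Suc n) \<phi>"

definition formulas :: "('f, 'r) language \<Rightarrow> nat \<Rightarrow> ('f, 'r) fm set" where
  "formulas L n = {\<phi>. wf_fm L n \<phi>}"

record ('f, 'r, 'a) struct =
  Dom :: "'a set"
  fun_int :: "'f \<Rightarrow> 'a list \<Rightarrow> 'a"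
  rel_int :: "'r \<Rightarrow> 'a list \<Rightarrow> bool"

definition is_structure :: "('f, 'r) language \<Rightarrow> ('f, 'r, 'a) struct \<Rightarrow> bool" where
  "is_structure L M \<longleftrightarrow> Dom M \<noteq> {} \<and>
     (\<forall>f\<in>Funs L. \<forall>as\<in>lists (Dom M). length as = fun_arity L f \<longrightarrow> fun_int M f as \<in> Dom M)"

primrec eval :: "('f, 'r, 'a) struct \<Rightarrow> 'a list \<Rightarrow> 'f tm \<Rightarrow> 'a" where
  "eval M bs (Var i) = bs ! i"
| "eval M bs (App f ts) = fun_int M f (map (eval M bs) ts)"

primrec sat :: "('f, 'r, 'a) struct \<Rightarrow> 'a list \<Rightarrow> ('f, 'r) fm \<Rightarrow> bool" where
  "sat M bs (Eq s t) \<longleftrightarrow> eval M bs s = eval M bs t"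
| "sat M bs (Rel r ts) \<longleftrightarrow> rel_int M r (map (eval M bs) ts)"
| "sat M bs (Neg \<phi>) \<longleftrightarrow> \<not> sat M bs \<phi>"
| "sat M bs (Conj \<phi> \<psi>) \<longleftrightarrow> sat M bs \<phi> \<and> sat M bs \<psi>"
| "sat M bs (Ex \<phi>) \<longleftrightarrow> (\<exists>a\<in>Dom M. sat M (a # bs) \<phi>)"

definition elementarily_equivalent ::
    "('f, 'r) language \<Rightarrow> ('f, 'r, 'a) struct \<Rightarrow> ('f, 'r, 'b) struct \<Rightarrow> bool" where
  "elementarily_equivalent L M N \<longleftrightarrow> (\<forall>\<phi>\<in>formulas L 0. sat M [] \<phi> \<longleftrightarrow> sat N [] \<phi>)"

definition isomorphic ::
    "('f, 'r) language \<Rightarrow> ('f, 'r, 'a) struct \<Rightarrow> ('f, 'r, 'b) struct \<Rightarrow> bool" where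
  "isomorphic L M N \<longleftrightarrow> (\<exists>h. bij_betw h (Dom M) (Dom N) \<and>
     (\<forall>f\<in>Funs L. \<forall>as\<in>lists (Dom M). length as = fun_arity L f \<longrightarrow>
        h (fun_int M f as) = fun_int N f (map h as)) \<and>
     (\<forall>r\<in>Rels L. \<forall>as\<in>lists (Dom M). length as = rel_arity L r \<longrightarrow>
        (rel_int M r as \<longleftrightarrow> rel_int N r (map h as))))"

definition elementary_embedding ::
    "('f, 'r) language \<Rightarrow> ('a \<Rightarrow> 'b) \<Rightarrow> ('f, 'r, 'a) struct \<Rightarrow> ('f, 'r, 'b) struct \<Rightarrow> bool" where
  "elementary_embedding L h M N \<longleftrightarrow> h ` Dom M \<subseteq> Dom N \<and>
     (\<forall>n. \<forall>\<phi>\<in>formulas L n. \<forall>bs\<in>lists (Dom M). length bs = n \<longrightarrow>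
        (sat M bs \<phi> \<longleftrightarrow> sat N (map h bs) \<phi>))"

text \<open>
  A proper extension of \<open>M\<close> may need elements outside the type \<open>'a\<close> that \<open>M\<close> lives on. Extensions
  are therefore taken in a disjoint sum \<open>'a + 'c\<close>, the elements of \<open>M\<close> being identified with
  their images under \<open>Inl\<close>.
\<close>

definition elementary_extension ::
    "('f, 'r) language \<Rightarrow> ('f, 'r, 'a) struct \<Rightarrow> ('f, 'r, 'a + 'c) struct \<Rightarrow> bool" where
  "elementary_extension L M N \<longleftrightarrow> is_structure L N \<and> elementary_embedding L Inl M N"

definition unary_type :: "('f, 'r) language \<Rightarrow> ('f, 'r) fm set \<Rightarrow> bool" where
  "unary_type L p \<longleftrightarrow> p \<subseteq> formulas L 1"

definition omits :: "('f, 'r, 'a) struct \<Rightarrow> ('f, 'r) fm set \<Rightarrow> bool" where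
  "omits M p \<longleftrightarrow> \<not> (\<exists>a\<in>Dom M. \<forall>\<phi>\<in>p. sat M [a] \<phi>)"

definition choice_functions ::
    "('f, 'r) fm set set \<Rightarrow> (('f, 'r) fm set \<Rightarrow> ('f, 'r) fm) set" where
  "choice_functions \<Gamma> = (\<Pi>\<^sub>E p\<in>\<Gamma>. p)"

definition witnessed ::
    "('f, 'r) fm set set \<Rightarrow> ('f, 'r, 'a) struct \<Rightarrow> 'a
      \<Rightarrow> (('f, 'r) fm set \<Rightarrow> ('f, 'r) fm) \<Rightarrow> bool" where
  "witnessed \<Gamma> M a C \<longleftrightarrow> (\<forall>p\<in>\<Gamma>. sat M [a] (Neg (C p)))"

definition nice ::
    "('f, 'r) language \<Rightarrow> ('f, 'r) fm set set \<Rightarrow> ('f, 'r, 'a) struct \<Rightarrow> bool" where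
  "nice L \<Gamma> M \<longleftrightarrow> (\<forall>n. \<forall>\<phi>\<in>formulas L (Suc n).
     \<exists>g \<in> {Cs \<in> lists (choice_functions \<Gamma>). length Cs = n} \<rightarrow> choice_functions \<Gamma>.
       \<forall>Cs\<in>lists (choice_functions \<Gamma>). \<forall>bs\<in>lists (Dom M).
         length Cs = n \<and> length bs = n \<and> (\<forall>i<n. witnessed \<Gamma> M (bs ! i) (Cs ! i)) \<and>
         sat M bs (Ex \<phi>) \<longrightarrow>
         (\<exists>m\<in>Dom M. sat M (m # bs) \<phi> \<and> (\<forall>p\<in>\<Gamma>. sat M [m] (Neg (g Cs p)))))"

text \<open>
  Quantification over all structures, or over all cardinalities, ranges over several types. In a
  theorem of the form \<open>(\<forall>N :: ('f, 'r, 'b) struct. A N) \<or> (\<forall>K :: 'c set. B K)\<close> the type variables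
  \<open>'b\<close> and \<open>'c\<close> are universally quantified at the outside and each occurs in one disjunct only, so
  the theorem says that the first disjunct holds for all \<open>'b\<close> or the second for all \<open>'c\<close>.

  A cardinality is represented by a set \<open>K\<close>. For an infinite \<open>K\<close>, the existence of an elementary
  extension of size \<open>K\<close> can only be expected if \<open>K\<close> is at least as large as \<open>M\<close> and, as in the
  upward Loewenheim-Skolem theorem, as \<open>L\<close>: for the natural numbers with all finitary functions
  and relations, every proper elementary extension has at least continuum many elements.
\<close>

end

theory Submission
  imports Defs "HOL-Analysis.Finite_Cartesian_Product"
begin

text \<open>
  Call an element witnessed if some choice function witnesses it. A structure omits every type in
  \<open>\<Gamma>\<close> iff all its elements are witnessed. If every choice function witnesses only finitely many
  elements of \<open>M\<close>, then the same holds, with the same numbers, in every \<open>N\<close> equivalent to \<open>M\<close>.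
  If \<open>N\<close> moreover omits \<open>\<Gamma>\<close>, it is countable, and any partial elementary map extends to one more
  element \<open>b\<close>: the candidates for its image are the finitely many elements of \<open>M\<close> with the same
  witness, and if each failed through some formula, then so would the conjunction of these formulas.
  The resulting elementary map \<open>N \<rightarrow> M\<close> is onto by counting.

  Otherwise some choice function witnesses infinitely many elements of \<open>M\<close>, hence at least \<open>|K|\<close>
  elements of a suitable ultrapower. By niceness, which transfers by Los's theorem, the witnessed
  elements of the ultrapower pass the Tarski-Vaught test; a Skolem hull among them has size \<open>|K|\<close>
  and omits \<open>\<Gamma>\<close>.
\<close>

subsection \<open>Cardinality of generated sets\<close>

lemma infinite_times_lepoll:
  includes cardinal_syntax
  assumes "infinite K" "A \<lesssim> K" "B \<lesssim> K"
  shows "A \<times> B \<lesssim> K"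
proof -
  have "|A \<times> B| \<le>o |K|"
    using assms by (intro card_of_Sigma_ordLeq_infinite) (auto simp: lepoll_def card_of_ordLeq)
  then show ?thesis
    by (auto simp: lepoll_def card_of_ordLeq)
qed

lemma infinite_UN_nat_lepoll:
  includes cardinal_syntax
  fixes A :: "nat \<Rightarrow> 'a set"
  assumes "infinite K" "\<And>n. A n \<lesssim> K"
  shows "(\<Union>n. A n) \<lesssim> K"
proof -
  have "|\<Union>n. A n| \<le>o |K|"
  proof (rule card_of_UNION_ordLeq_infinite)
    show "|UNIV :: nat set| \<le>o |K|"
      using assms(1) by (simp add: infinite_iff_card_of_nat)
    show "\<forall>n\<in>UNIV. |A n| \<le>o |K|"
      using assms(2) by (auto simp: lepoll_def card_of_ordLeq)
  qed (fact assms)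
  then show ?thesis
    by (auto simp: lepoll_def card_of_ordLeq)
qed

lemma infinite_Un_lepoll:
  assumes "infinite K" "A \<lesssim> K" "B \<lesssim> K"
  shows "A \<union> B \<lesssim> K"
proof -
  have "(\<Union>n::nat. if n = 0 then A else B) \<lesssim> K"
    by (rule infinite_UN_nat_lepoll) (use assms in auto)
  moreover have "A \<union> B = (\<Union>n::nat. if n = 0 then A else B)"
    by (auto split: if_splits)
  ultimately show ?thesis
    by simp
qed

text \<open>Prepending an entry costs one product with A, so each length contributes at most |K|
  lists, and there are only countably many lengths.\<close>

lemma infinite_lists_lepoll:
  assumes "infinite K" "A \<lesssim> K"
  shows "lists A \<lesssim> K"
proof -
  have "{xs \<in> lists A. length xs = n} \<lesssim> K" for n
  proof (induction n)
    case 0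
    have "{xs \<in> lists A. length xs = 0} = {[]}"
      by auto
    then show ?case
      using assms(1) by (simp add: finite_lepoll_infinite)
  next
    case (Suc n)
    have "{xs \<in> lists A. length xs = Suc n}
        \<subseteq> (\<lambda>(x, xs). x # xs) ` (A \<times> {xs \<in> lists A. length xs = n})"
      by (auto simp: length_Suc_conv image_iff)
    then show ?case
      by (rule lepoll_trans[OF subset_image_lepoll infinite_times_lepoll[OF assms Suc]])
  qed
  then have "(\<Union>n. {xs \<in> lists A. length xs = n}) \<lesssim> K"
    by (rule infinite_UN_nat_lepoll[OF assms(1)])
  moreover have "lists A = (\<Union>n. {xs \<in> lists A. length xs = n})"
    by auto
  ultimately show ?thesis
    by simp
qed

text \<open>An operation may be applied to finite lists of any length. Ignoring arities only
  enlarges the set and does not affect the bound \<open>generated_lepoll\<close>, so that one bound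
  serves terms, formulas and the Skolem hull.\<close>

inductive_set generated :: "'a set \<Rightarrow> 's set \<Rightarrow> ('s \<Rightarrow> 'a list \<Rightarrow> 'a) \<Rightarrow> 'a set"
  for B S g where
  base: "x \<in> B \<Longrightarrow> x \<in> generated B S g"
| step: "s \<in> S \<Longrightarrow> \<forall>x\<in>set xs. x \<in> generated B S g \<Longrightarrow> g s xs \<in> generated B S g"

lemma generated_lepoll:
  assumes K: "infinite K" and B: "B \<lesssim> K" and S: "S \<lesssim> K"
  shows "generated B S g \<lesssim> K"
proof -
  \<comment> \<open>\<open>X n\<close> is the result of n rounds of applying the operations to B;
    the bound is kept in each round.\<close>
  define X where "X = rec_nat B (\<lambda>_ Y. Y \<union> (\<lambda>(s, xs). g s xs) ` (S \<times> lists Y))"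
  have X0: "X 0 = B" and XSuc: "X (Suc n) = X n \<union> (\<lambda>(s, xs). g s xs) ` (S \<times> lists (X n))" for n
    by (simp_all add: X_def)
  have "X n \<lesssim> K" for n
  proof (induction n)
    case 0
    then show ?case using B by (simp add: X0)
  next
    case (Suc n)
    show ?case
      unfolding XSuc
      by (intro infinite_Un_lepoll K Suc lepoll_trans[OF image_lepoll]
          infinite_times_lepoll S infinite_lists_lepoll)
  qed
  then have "(\<Union>n. X n) \<lesssim> K"
    by (rule infinite_UN_nat_lepoll[OF K])
  moreover have "generated B S g \<subseteq> (\<Union>n. X n)"
  proof
    have mono: "mono X"
      by (rule mono_iff_le_Suc[THEN iffD2]) (auto simp: XSuc)
    fix x assume "x \<in> generated B S g"
    then show "x \<in> (\<Union>n. X n)"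
    proof induction
      case (base x)
      then show ?case using X0 by auto
    next
      case (step s xs)
      then obtain r where r: "\<forall>x\<in>set xs. x \<in> X (r x)"
        by (metis UN_E)
      \<comment> \<open>The finitely many entries lie in a common stage. For the empty list
        \<open>Max\<close> is unspecified, and any stage will do.\<close>
      define n where "n = Max (r ` set xs)"
      have "x \<in> X n" if "x \<in> set xs" for x
        using monoD[OF mono, of "r x" n] r that by (auto simp: n_def)
      then have "g s xs \<in> X (Suc n)"
        using step.hyps(1) by (auto simp: XSuc image_iff intro!: bexI[of _ s] bexI[of _ xs])
      then show ?case by blast
    qed
  qed
  ultimately show ?thesis
    by (meson lepoll_trans subset_imp_lepoll)
qed

subsection \<open>Formulas and structures\<close>

lemma wf_tms_lepoll:
  assumes "infinite K" "Funs L \<lesssim> K"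
  shows "{t. wf_tm L n t} \<lesssim> K"
proof -
  have nat: "range Var \<lesssim> K"
    by (rule lepoll_trans[OF image_lepoll]) (use assms(1) infinite_le_lepoll in blast)
  have "t \<in> generated (range Var) (Funs L) App" if "wf_tm L n t" for t
    using that
  proof (induction t)
    case (App f ts)
    then show ?case
      by (intro generated.step) (auto simp: list_all_iff)
  qed (auto intro: generated.base)
  then have "{t. wf_tm L n t} \<subseteq> generated (range Var) (Funs L) App"
    by blast
  then show ?thesis
    by (rule lepoll_trans[OF subset_imp_lepoll generated_lepoll[OF assms(1) nat assms(2)]])
qed

lemma wf_fms_lepoll:
  fixes L :: "('f, 'r) language"
  assumes K: "infinite K" and L: "Funs L <+> Rels L \<lesssim> K"
  shows "{\<phi>. \<exists>n. wf_fm L n \<phi>} \<lesssim> K"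
proof -
  have F: "Funs L \<lesssim> K"
    by (rule lepoll_trans[OF _ L]) (auto simp: lepoll_def intro!: exI[of _ Inl])
  have R: "Rels L \<lesssim> K"
    by (rule lepoll_trans[OF _ L]) (auto simp: lepoll_def intro!: exI[of _ Inr])
  define T where "T = (\<Union>n. {t. wf_tm L n t})"
  have T: "T \<lesssim> K"
    unfolding T_def by (intro infinite_UN_nat_lepoll K wf_tms_lepoll F)
  define B where "B = (\<lambda>(s, t). Eq s t) ` (T \<times> T) \<union> (\<lambda>(r, ts). Rel r ts) ` (Rels L \<times> lists T)"
  \<comment> \<open>The numbers 0 and 1 code negation and conjunction, all others the existential
    quantifier. Junk values on lists that are too short only enlarge the generated set.\<close>
  define g :: "nat \<Rightarrow> ('f, 'r) fm list \<Rightarrow> ('f, 'r) fm" where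
    "g s xs = (if s = 0 then Neg (xs ! 0) else if s = 1 then Conj (xs ! 0) (xs ! 1) else Ex (xs ! 0))"
    for s xs
  have g: "g 0 [\<phi>] = Neg \<phi>" "g (Suc 0) [\<phi>, \<psi>] = Conj \<phi> \<psi>" "g 2 [\<phi>] = Ex \<phi>" for \<phi> \<psi>
    by (simp_all add: g_def)
  have B: "B \<lesssim> K"
    unfolding B_def
    by (intro infinite_Un_lepoll K lepoll_trans[OF image_lepoll]
        infinite_times_lepoll T R infinite_lists_lepoll)
  have nat: "(UNIV :: nat set) \<lesssim> K"
    using K by (simp add: infinite_le_lepoll)
  have "\<phi> \<in> generated B UNIV g" if "wf_fm L n \<phi>" for \<phi> n
    using that
  proof (induction \<phi> arbitrary: n)
    case (Eq s t)
    then show ?case by (auto simp: B_def T_def intro!: generated.base)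
  next
    case (Rel r ts)
    then show ?case by (auto simp: B_def T_def list_all_iff image_iff intro!: generated.base)
  next
    case (Neg \<phi>)
    then show ?case using generated.step[of 0 UNIV "[\<phi>]" B g] by (auto simp: g)
  next
    case (Conj \<phi> \<psi>)
    then show ?case using generated.step[of 1 UNIV "[\<phi>, \<psi>]" B g] by (auto simp: g)
  next
    case (Ex \<phi>)
    then show ?case using generated.step[of 2 UNIV "[\<phi>]" B g] by (auto simp: g)
  qed
  then have "{\<phi>. \<exists>n. wf_fm L n \<phi>} \<subseteq> generated B UNIV g"
    by blast
  then show ?thesis
    by (rule lepoll_trans[OF subset_imp_lepoll generated_lepoll[OF K B nat]])
qed

lemma eval_cong:
  "wf_tm L n t \<Longrightarrow> (\<And>i. i < n \<Longrightarrow> bs ! i = cs ! i) \<Longrightarrow> eval M bs t = eval M cs t"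
proof (induction t)
  case (App f ts)
  then have "map (eval M bs) ts = map (eval M cs) ts"
    by (auto simp: list_all_iff)
  then show ?case
    by (simp only: eval.simps)
qed simp

lemma sat_cong:
  "wf_fm L n \<phi> \<Longrightarrow> (\<And>i. i < n \<Longrightarrow> bs ! i = cs ! i) \<Longrightarrow> sat M bs \<phi> \<longleftrightarrow> sat M cs \<phi>"
proof (induction \<phi> arbitrary: n bs cs)
  case (Eq s t)
  then show ?case
    using eval_cong[of L n _ bs cs M] by simp
next
  case (Rel r ts)
  then have "map (eval M bs) ts = map (eval M cs) ts"
    using eval_cong[of L n _ bs cs M] by (auto simp: list_all_iff)
  then show ?case
    by (simp only: sat.simps)
next
  case (Neg \<phi>)
  then show ?case by (metis sat.simps(3) wf_fm.simps(3))
next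
  case (Conj \<phi> \<psi>)
  then show ?case by (metis sat.simps(4) wf_fm.simps(4))
next
  case (Ex \<phi>)
  have "sat M (a # bs) \<phi> \<longleftrightarrow> sat M (a # cs) \<phi>" for a
    by (rule Ex.IH[of "Suc n"]) (use Ex.prems in \<open>auto simp: nth_Cons split: nat.splits\<close>)
  then show ?case by simp
qed

lemma eval_in_Dom:
  assumes "is_structure L M" "wf_tm L n t" "bs \<in> lists (Dom M)" "length bs = n"
  shows "eval M bs t \<in> Dom M"
  using assms(2)
proof (induction t)
  case (Var i)
  then show ?case using assms by auto
next
  case (App f ts)
  then have "map (eval M bs) ts \<in> lists (Dom M)"
    by (auto simp: list_all_iff)
  then show ?case
    using App assms(1) unfolding is_structure_def by (metis eval.simps(2) length_map wf_tm.simps(2))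
qed

section \<open>Isomorphic copies and elementary substructures\<close>

definition image_struct :: "('a \<Rightarrow> 'b) \<Rightarrow> ('f, 'r, 'a) struct \<Rightarrow> ('f, 'r, 'b) struct" where
  "image_struct j U = \<lparr>Dom = j ` Dom U,
     fun_int = \<lambda>f as. j (fun_int U f (map (inv_into (Dom U) j) as)),
     rel_int = \<lambda>r as. rel_int U r (map (inv_into (Dom U) j) as)\<rparr>"

text \<open>This later moves a substructure of the ultrapower, whose elements are sequences, to a
  structure on \<open>'a + 'c\<close>. Injectivity lets arguments be pulled back along j and makes
  equations reflect.\<close>

lemma image_struct:
  assumes U: "is_structure L U" and inj: "inj_on j (Dom U)"
  shows "is_structure L (image_struct j U)"
    and "elementary_embedding L j U (image_struct j U)"
proof -
  let ?N = "image_struct j U"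
  have inv: "map (inv_into (Dom U) j \<circ> j) as = as" if "as \<in> lists (Dom U)" for as
    using that inj by (auto simp: map_idI)
  show "is_structure L ?N"
    unfolding is_structure_def
  proof (intro conjI ballI impI)
    show "Dom ?N \<noteq> {}"
      using U by (auto simp: image_struct_def is_structure_def)
    fix f as
    assume "f \<in> Funs L" "as \<in> lists (Dom ?N)" "length as = fun_arity L f"
    moreover from this obtain cs where "cs \<in> lists (Dom U)" "as = map j cs"
      by (auto simp: image_struct_def lists_image)
    ultimately show "fun_int ?N f as \<in> Dom ?N"
      using U inv by (auto simp: image_struct_def is_structure_def)
  qed
  have fun_N: "fun_int ?N f (map j as) = j (fun_int U f as)" if "as \<in> lists (Dom U)" for f as
    using inv[OF that] by (simp add: image_struct_def)
  have rel_N: "rel_int ?N r (map j as) = rel_int U r as" if "as \<in> lists (Dom U)" for r as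
    using inv[OF that] by (simp add: image_struct_def)
  have ev: "eval ?N (map j bs) t = j (eval U bs t)"
    if "wf_tm L n t" "bs \<in> lists (Dom U)" "length bs = n" for n t bs
    using that(1)
  proof (induction t)
    case (App f ts)
    then have "map (eval ?N (map j bs)) ts = map j (map (eval U bs) ts)"
      by (auto simp: list_all_iff)
    moreover have "map (eval U bs) ts \<in> lists (Dom U)"
      using App that eval_in_Dom[OF U, of n _ bs] by (auto simp: list_all_iff)
    ultimately show ?case
      using fun_N[of "map (eval U bs) ts" f] by (simp only: eval.simps)
  qed (use that in auto)
  have "sat U bs \<phi> \<longleftrightarrow> sat ?N (map j bs) \<phi>"
    if "wf_fm L n \<phi>" "bs \<in> lists (Dom U)" "length bs = n" for n \<phi> bs
    using that
  proof (induction \<phi> arbitrary: n bs)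
    case (Eq s t)
    then show ?case
      using ev[of n _ bs] eval_in_Dom[OF U, of n _ bs] inj by (simp add: inj_on_eq_iff)
  next
    case (Rel r ts)
    then have "map (eval ?N (map j bs)) ts = map j (map (eval U bs) ts)"
      using ev[of n _ bs] by (auto simp: list_all_iff)
    moreover have "map (eval U bs) ts \<in> lists (Dom U)"
      using Rel eval_in_Dom[OF U, of n _ bs] by (auto simp: list_all_iff)
    ultimately show ?case
      using rel_N[of "map (eval U bs) ts" r] by (simp only: sat.simps)
  next
    case (Neg \<phi>)
    then show ?case by (metis sat.simps(3) wf_fm.simps(3))
  next
    case (Conj \<phi> \<psi>)
    then show ?case by (metis sat.simps(4) wf_fm.simps(4))
  next
    case (Ex \<phi>)
    have "sat U (a # bs) \<phi> \<longleftrightarrow> sat ?N (map j (a # bs)) \<phi>" if "a \<in> Dom U" for a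
      by (rule Ex.IH[of "Suc n"]) (use Ex.prems that in auto)
    then show ?case by (auto simp: image_struct_def)
  qed
  then show "elementary_embedding L j U ?N"
    unfolding elementary_embedding_def formulas_def by (auto simp: image_struct_def)
qed

text \<open>In the existential case of the induction the test trades a witness in U for one in S.
  Closure of S under the functions is itself an instance of the test, for the formula x =
  f(ys).\<close>

lemma tarski_vaught:
  assumes U: "is_structure L U" and S: "S \<subseteq> Dom U" "S \<noteq> {}"
    and test: "\<And>n \<phi> bs. \<phi> \<in> formulas L (Suc n) \<Longrightarrow> bs \<in> lists S \<Longrightarrow> length bs = n \<Longrightarrow>
      sat U bs (Ex \<phi>) \<Longrightarrow> \<exists>m\<in>S. sat U (m # bs) \<phi>"
  shows "is_structure L (U\<lparr>Dom := S\<rparr>)"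
    and "elementary_embedding L (\<lambda>x. x) (U\<lparr>Dom := S\<rparr>) U"
proof -
  let ?V = "U\<lparr>Dom := S\<rparr>"
  show "is_structure L ?V"
    unfolding is_structure_def
  proof (intro conjI ballI impI)
    show "Dom ?V \<noteq> {}"
      using S by simp
    fix f as
    assume f: "f \<in> Funs L" and as: "as \<in> lists (Dom ?V)" and len: "length as = fun_arity L f"
    \<comment> \<open>Index 0 is reserved for the value of f, so the arguments start at index
      1.\<close>
    define ts :: "'a tm list" where "ts = map (\<lambda>i. Var (Suc i)) [0..<length as]"
    have ev: "map (eval U (m # as)) ts = as" for m
      by (auto simp: ts_def intro: nth_equalityI)
    have "as \<in> lists (Dom U)"
      using as S by auto
    then have "fun_int U f as \<in> Dom U"
      using U f len by (auto simp: is_structure_def)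
    then have "sat U as (Ex (Eq (Var 0) (App f ts)))"
      by (simp add: ev)
    moreover have "Eq (Var 0) (App f ts) \<in> formulas L (Suc (length as))"
      using f len by (auto simp: formulas_def ts_def list_all_iff)
    ultimately obtain m where "m \<in> S" "sat U (m # as) (Eq (Var 0) (App f ts))"
      using test as by (metis select_convs(1) surjective update_convs(1))
    then show "fun_int ?V f as \<in> Dom ?V"
      by (simp add: ev)
  qed
  have ev: "eval ?V bs t = eval U bs t" for bs t
  proof (induction t)
    case (App f ts)
    then have "map (eval ?V bs) ts = map (eval U bs) ts"
      by auto
    then show ?case by (simp del: map_eq_conv)
  qed simp
  have "sat ?V bs \<phi> \<longleftrightarrow> sat U bs \<phi>"
    if "wf_fm L n \<phi>" "bs \<in> lists S" "length bs = n" for n \<phi> bs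
    using that
  proof (induction \<phi> arbitrary: n bs)
    case (Rel r ts)
    then show ?case using ev by (simp add: ext[of "eval ?V bs" "eval U bs"])
  next
    case (Ex \<phi>)
    have "sat ?V (a # bs) \<phi> \<longleftrightarrow> sat U (a # bs) \<phi>" if "a \<in> S" for a
      by (rule Ex.IH[of "Suc n"]) (use Ex.prems that in auto)
    moreover have "\<exists>m\<in>S. sat U (m # bs) \<phi>" if "sat U bs (Ex \<phi>)"
      using that test[of \<phi> n bs] Ex.prems by (simp add: formulas_def)
    ultimately show ?case using S by auto
  qed (auto simp: ev)
  then show "elementary_embedding L (\<lambda>x. x) ?V U"
    unfolding elementary_embedding_def formulas_def using S by auto
qed

subsection \<open>Ultrapowers\<close>

definition ultrafilter :: "'i filter \<Rightarrow> bool" where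
  "ultrafilter F \<longleftrightarrow> F \<noteq> bot \<and> (\<forall>P. eventually P F \<or> eventually (\<lambda>i. \<not> P i) F)"

text \<open>A smaller filter has more events, so ultrafilters are the minimal proper filters, and
  Zorn's lemma is applied to the reversed order.\<close>

lemma ultrafilter_exists:
  assumes "F0 \<noteq> bot"
  shows "\<exists>F\<le>F0. ultrafilter F"
proof -
  define A where "A = {F. F \<noteq> bot \<and> F \<le> F0}"
  have "\<exists>F\<in>A. \<forall>G\<in>A. G \<le> F \<longrightarrow> G = F"
  proof (rule predicate_Zorn[of A "\<lambda>F G. G \<le> F"])
    show "partial_order_on A (relation_of (\<lambda>F G. G \<le> F) A)"
      by (rule partial_order_on_relation_ofI) auto
    fix C assume C: "C \<in> Chains (relation_of (\<lambda>F G. G \<le> F) A)"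
    then have sub: "C \<subseteq> A" and total: "\<And>F G. F \<in> C \<Longrightarrow> G \<in> C \<Longrightarrow> F \<le> G \<or> G \<le> F"
      by (auto simp: Chains_def relation_of_def)
    show "\<exists>U\<in>A. \<forall>F\<in>C. U \<le> F"
    proof (cases "C = {}")
      case True
      then show ?thesis using assms by (auto simp: A_def)
    next
      case False
      \<comment> \<open>An event of the infimum of a chain is already an event of some member, so
        the infimum of proper filters stays proper.\<close>
      have ev: "eventually P (Inf C) \<longleftrightarrow> (\<exists>F\<in>C. eventually P F)" for P
      proof (rule eventually_Inf_base[OF False])
        fix F G assume "F \<in> C" "G \<in> C"
        then show "\<exists>H\<in>C. H \<le> inf F G"
          using total[of F G] by (auto intro: bexI[of _ F] bexI[of _ G])
      qed
      have "Inf C \<noteq> bot"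
        using sub ev[of "\<lambda>_. False"] by (auto simp: A_def trivial_limit_def)
      moreover have "Inf C \<le> F0"
        using False sub by (auto simp: A_def intro: Inf_lower2)
      ultimately show ?thesis
        by (auto simp: A_def Inf_lower intro!: bexI[of _ "Inf C"])
    qed
  qed
  then obtain F where F: "F \<noteq> bot" "F \<le> F0"
    and max: "\<And>G. G \<noteq> bot \<Longrightarrow> G \<le> F \<Longrightarrow> G = F"
    by (auto simp: A_def intro: order_trans)
  have "eventually P F \<or> eventually (\<lambda>i. \<not> P i) F" for P
  \<comment> \<open>Refining F by P yields either the improper filter, and then P fails eventually,
    or F itself by minimality.\<close>
  proof (cases "inf F (principal {i. P i}) = bot")
    case True
    then have "eventually (\<lambda>i. \<not> P i) F"
      by (simp add: trivial_limit_def eventually_inf_principal)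
    then show ?thesis ..
  next
    case False
    then have "inf F (principal {i. P i}) = F"
      using max by simp
    moreover have "eventually P (inf F (principal {i. P i}))"
      by (simp add: eventually_inf_principal)
    ultimately have "eventually P F"
      by simp
    then show ?thesis ..
  qed
  then show ?thesis
    using F unfolding ultrafilter_def by blast
qed

lemma eventually_not_ultrafilter:
  assumes "ultrafilter F"
  shows "eventually (\<lambda>i. \<not> P i) F \<longleftrightarrow> \<not> eventually P F"
proof
  assume "eventually (\<lambda>i. \<not> P i) F"
  then have "eventually (\<lambda>_. False) F" if "eventually P F"
    using that by eventually_elim simp
  then show "\<not> eventually P F"
    using assms by (auto simp: ultrafilter_def trivial_limit_def)
qed (use assms in \<open>auto simp: ultrafilter_def\<close>)

text \<open>
  The elements of the ultrapower are canonical representatives of the classes of sequences, so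
  that every element is itself a sequence.
\<close>

locale ultrapower =
  fixes L :: "('f, 'r) language" and M :: "('f, 'r, 'a) struct" and F :: "'i filter"
  assumes struct: "is_structure L M" and ultra: "ultrafilter F"
begin

definition seqs :: "('i \<Rightarrow> 'a) set" where
  "seqs = {s. \<forall>i. s i \<in> Dom M}"

definition cls :: "('i \<Rightarrow> 'a) \<Rightarrow> 'i \<Rightarrow> 'a" where
  "cls s = (SOME t. t \<in> seqs \<and> (\<forall>\<^sub>F i in F. t i = s i))"

definition UP :: "('f, 'r, 'i \<Rightarrow> 'a) struct" where
  "UP = \<lparr>Dom = cls ` seqs,
     fun_int = \<lambda>f as. cls (\<lambda>i. fun_int M f (map (\<lambda>a. a i) as)),
     rel_int = \<lambda>r as. \<forall>\<^sub>F i in F. rel_int M r (map (\<lambda>a. a i) as)\<rparr>"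

lemma cls:
  assumes "s \<in> seqs"
  shows "cls s \<in> seqs" "\<forall>\<^sub>F i in F. cls s i = s i"
proof -
  have "cls s \<in> seqs \<and> (\<forall>\<^sub>F i in F. cls s i = s i)"
    unfolding cls_def by (rule someI[of _ s]) (use assms in auto)
  then show "cls s \<in> seqs" "\<forall>\<^sub>F i in F. cls s i = s i"
    by auto
qed

lemma cls_eq_iff:
  assumes "s \<in> seqs" "t \<in> seqs"
  shows "cls s = cls t \<longleftrightarrow> (\<forall>\<^sub>F i in F. s i = t i)"
proof
  assume "cls s = cls t"
  then show "\<forall>\<^sub>F i in F. s i = t i"
    using cls(2)[OF assms(1)] cls(2)[OF assms(2)] by (auto elim: eventually_elim2)
next
  \<comment> \<open>The conditions defining the representatives of s and t are equivalent, so
    \<open>SOME\<close> picks the same sequence for both.\<close>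
  assume *: "\<forall>\<^sub>F i in F. s i = t i"
  have "(\<forall>\<^sub>F i in F. u i = s i) \<longleftrightarrow> (\<forall>\<^sub>F i in F. u i = t i)" for u
    using * by (auto elim: eventually_elim2)
  then show "cls s = cls t"
    by (simp add: cls_def)
qed

lemma Dom_UP:
  assumes "u \<in> Dom UP"
  shows "u \<in> seqs" "cls u = u" "u i \<in> Dom M"
proof -
  obtain s where s: "s \<in> seqs" "u = cls s"
    using assms by (auto simp: UP_def)
  then show "u \<in> seqs"
    using cls by simp
  then show "cls u = u" "u i \<in> Dom M"
    using s cls cls_eq_iff by (auto simp: seqs_def)
qed

lemma Dom_UP_eq_iff:
  assumes "u \<in> Dom UP" "v \<in> Dom UP"
  shows "u = v \<longleftrightarrow> (\<forall>\<^sub>F i in F. u i = v i)"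
  using assms Dom_UP cls_eq_iff by metis

text \<open>At each index a suitable m is picked if there is one, and an arbitrary element of
  \<open>Dom M\<close> otherwise. This supplies the witnesses both in Los's theorem and in the
  transfer of niceness.\<close>

lemma UP_choice:
  assumes "\<forall>\<^sub>F i in F. \<exists>m\<in>Dom M. Q i m"
  shows "\<exists>u\<in>Dom UP. \<forall>\<^sub>F i in F. Q i (u i)"
proof -
  have "\<exists>m\<in>Dom M. (\<exists>m\<in>Dom M. Q i m) \<longrightarrow> Q i m" for i
    using struct unfolding is_structure_def by blast
  then obtain s where s: "\<And>i. s i \<in> Dom M" "\<And>i. (\<exists>m\<in>Dom M. Q i m) \<longrightarrow> Q i (s i)"
    by metis
  then have seq: "s \<in> seqs"
    by (simp add: seqs_def)
  have "\<forall>\<^sub>F i in F. Q i (cls s i)"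
    using assms cls(2)[OF seq] by eventually_elim (use s in auto)
  then show ?thesis
    using seq by (auto simp: UP_def)
qed

lemma fun_int_seqs:
  assumes "f \<in> Funs L" "as \<in> lists (Dom UP)" "length as = fun_arity L f"
  shows "(\<lambda>i. fun_int M f (map (\<lambda>a. a i) as)) \<in> seqs"
proof -
  have "map (\<lambda>a. a i) as \<in> lists (Dom M)" for i
    using assms(2) Dom_UP by auto
  then show ?thesis
    using assms struct by (auto simp: seqs_def is_structure_def)
qed

lemma struct_UP: "is_structure L UP"
proof -
  have "Dom UP \<noteq> {}"
    using struct
    by (auto simp: UP_def seqs_def is_structure_def
        intro!: exI[of _ "\<lambda>_. SOME a. a \<in> Dom M"] some_in_eq[THEN iffD2])
  then show ?thesis
    using fun_int_seqs by (auto simp: is_structure_def UP_def)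
qed

lemma eval_UP:
  assumes "bs \<in> lists (Dom UP)" "length bs = n" "wf_tm L n t"
  shows "\<forall>\<^sub>F i in F. eval UP bs t i = eval M (map (\<lambda>b. b i) bs) t"
  using assms(3)
proof (induction t)
  case (Var k)
  then show ?case using assms by simp
next
  case (App f ts)
  have dom: "map (eval UP bs) ts \<in> lists (Dom UP)"
    using App.prems assms eval_in_Dom[OF struct_UP, of n _ bs] by (auto simp: list_all_iff)
  have "\<forall>\<^sub>F i in F. \<forall>t\<in>set ts. eval UP bs t i = eval M (map (\<lambda>b. b i) bs) t"
    by (rule eventually_ball_finite) (use App in \<open>auto simp: list_all_iff\<close>)
  moreover have "\<forall>\<^sub>F i in F. eval UP bs (App f ts) i
      = fun_int M f (map (\<lambda>a. a i) (map (eval UP bs) ts))"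
    using cls(2)[OF fun_int_seqs[OF _ dom]] App.prems by (simp add: UP_def)
  ultimately show ?case
  proof eventually_elim
    case (elim i)
    then have "map (\<lambda>a. a i) (map (eval UP bs) ts) = map (eval M (map (\<lambda>b. b i) bs)) ts"
      by auto
    then show ?case using elim by (simp only: eval.simps)
  qed
qed

text \<open>Negation uses that F decides every event; the existential case gathers the witnesses at
  almost all indices into one sequence by \<open>UP_choice\<close>.\<close>

theorem Los:
  assumes "wf_fm L n \<phi>" "bs \<in> lists (Dom UP)" "length bs = n"
  shows "sat UP bs \<phi> \<longleftrightarrow> (\<forall>\<^sub>F i in F. sat M (map (\<lambda>b. b i) bs) \<phi>)"
  using assms
proof (induction \<phi> arbitrary: n bs)
  case (Eq s t)
  then have "eval UP bs s \<in> Dom UP" "eval UP bs t \<in> Dom UP"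
    using eval_in_Dom[OF struct_UP, of n _ bs] by auto
  then have "sat UP bs (Eq s t) \<longleftrightarrow> (\<forall>\<^sub>F i in F. eval UP bs s i = eval UP bs t i)"
    by (simp add: Dom_UP_eq_iff)
  moreover have "\<forall>\<^sub>F i in F. eval UP bs s i = eval M (map (\<lambda>b. b i) bs) s"
    "\<forall>\<^sub>F i in F. eval UP bs t i = eval M (map (\<lambda>b. b i) bs) t"
    using Eq eval_UP by auto
  then have "\<forall>\<^sub>F i in F. eval UP bs s i = eval UP bs t i \<longleftrightarrow> sat M (map (\<lambda>b. b i) bs) (Eq s t)"
    by eventually_elim auto
  ultimately show ?case
    by (simp only: eventually_subst)
next
  case (Rel r ts)
  have "\<forall>\<^sub>F i in F. \<forall>t\<in>set ts. eval UP bs t i = eval M (map (\<lambda>b. b i) bs) t"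
    by (rule eventually_ball_finite) (use Rel eval_UP in \<open>auto simp: list_all_iff\<close>)
  then have "\<forall>\<^sub>F i in F. rel_int M r (map (\<lambda>a. a i) (map (eval UP bs) ts))
      \<longleftrightarrow> sat M (map (\<lambda>b. b i) bs) (Rel r ts)"
  proof eventually_elim
    case (elim i)
    then have "map (\<lambda>a. a i) (map (eval UP bs) ts) = map (eval M (map (\<lambda>b. b i) bs)) ts"
      by auto
    then show ?case by (simp only: sat.simps)
  qed
  moreover have "sat UP bs (Rel r ts)
      \<longleftrightarrow> (\<forall>\<^sub>F i in F. rel_int M r (map (\<lambda>a. a i) (map (eval UP bs) ts)))"
    by (simp add: UP_def)
  ultimately show ?case
    by (simp only: eventually_subst)
next
  case (Neg \<phi>)
  then have "sat UP bs \<phi> \<longleftrightarrow> (\<forall>\<^sub>F i in F. sat M (map (\<lambda>b. b i) bs) \<phi>)"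
    by (metis wf_fm.simps(3))
  then show ?case
    by (simp add: eventually_not_ultrafilter[OF ultra])
next
  case (Conj \<phi> \<psi>)
  then have "sat UP bs \<phi> \<longleftrightarrow> (\<forall>\<^sub>F i in F. sat M (map (\<lambda>b. b i) bs) \<phi>)"
    "sat UP bs \<psi> \<longleftrightarrow> (\<forall>\<^sub>F i in F. sat M (map (\<lambda>b. b i) bs) \<psi>)"
    by (metis wf_fm.simps(4))+
  then show ?case
    by (simp add: eventually_conj_iff)
next
  case (Ex \<phi>)
  have IH: "sat UP (u # bs) \<phi> \<longleftrightarrow> (\<forall>\<^sub>F i in F. sat M (u i # map (\<lambda>b. b i) bs) \<phi>)"
    if "u \<in> Dom UP" for u
    using Ex.IH[of "Suc n" "u # bs"] Ex.prems that by simp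
  show ?case
  proof
    assume "sat UP bs (Ex \<phi>)"
    then obtain u where "u \<in> Dom UP" "\<forall>\<^sub>F i in F. sat M (u i # map (\<lambda>b. b i) bs) \<phi>"
      using IH by auto
    then show "\<forall>\<^sub>F i in F. sat M (map (\<lambda>b. b i) bs) (Ex \<phi>)"
      using Dom_UP by (auto elim!: eventually_mono)
  next
    assume "\<forall>\<^sub>F i in F. sat M (map (\<lambda>b. b i) bs) (Ex \<phi>)"
    then have "\<exists>u\<in>Dom UP. \<forall>\<^sub>F i in F. sat M (u i # map (\<lambda>b. b i) bs) \<phi>"
      by (intro UP_choice) simp
    then show "sat UP bs (Ex \<phi>)"
      using IH by auto
  qed
qed

section \<open>The diagonal embedding into the ultrapower\<close>

definition diag :: "'a \<Rightarrow> 'i \<Rightarrow> 'a" where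
  "diag a = cls (\<lambda>_. a)"

lemma diag:
  assumes "a \<in> Dom M"
  shows "diag a \<in> Dom UP" "\<forall>\<^sub>F i in F. diag a i = a"
  using assms cls by (auto simp: diag_def UP_def seqs_def)

lemma inj_diag: "inj_on diag (Dom M)"
proof (rule inj_onI)
  fix a b assume "a \<in> Dom M" "b \<in> Dom M" "diag a = diag b"
  then have "\<forall>\<^sub>F i in F. a = b"
    using diag(2)[of a] diag(2)[of b] by (auto elim: eventually_elim2)
  then show "a = b"
    using ultra by (simp add: ultrafilter_def eventually_const_iff)
qed

lemma elementary_embedding_diag: "elementary_embedding L diag M UP"
  unfolding elementary_embedding_def
proof (intro conjI allI ballI impI)
  show "diag ` Dom M \<subseteq> Dom UP"
    using diag by auto
  \<comment> \<open>The representative of a constant sequence is only known to be constant almost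
    everywhere; finitely many parameters can be treated at once.\<close>
  fix n \<phi> bs assume \<phi>: "\<phi> \<in> formulas L n" and bs: "bs \<in> lists (Dom M)" "length bs = n"
  have "\<forall>\<^sub>F i in F. \<forall>b\<in>set bs. diag b i = b"
    by (rule eventually_ball_finite) (use bs diag in auto)
  then have "\<forall>\<^sub>F i in F. map (\<lambda>b. b i) (map diag bs) = bs"
    by eventually_elim (simp add: map_idI)
  then have "\<forall>\<^sub>F i in F. sat M (map (\<lambda>b. b i) (map diag bs)) \<phi> \<longleftrightarrow> sat M bs \<phi>"
    by eventually_elim (simp only:)
  moreover have "sat UP (map diag bs) \<phi> \<longleftrightarrow> (\<forall>\<^sub>F i in F. sat M (map (\<lambda>b. b i) (map diag bs)) \<phi>)"
    by (rule Los) (use \<phi> bs diag in \<open>auto simp: formulas_def\<close>)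
  moreover have "(\<forall>\<^sub>F i in F. sat M bs \<phi>) \<longleftrightarrow> sat M bs \<phi>"
    using ultra by (simp add: ultrafilter_def eventually_const_iff)
  ultimately show "sat M bs \<phi> \<longleftrightarrow> sat UP (map diag bs) \<phi>"
    by (simp only: eventually_subst)
qed

end

subsection \<open>Witnessed elements\<close>

lemma choice_functions_wf:
  assumes "C \<in> choice_functions \<Gamma>" "p \<in> \<Gamma>" "unary_type L p"
  shows "C p \<in> p" "wf_fm L 1 (C p)"
  using assms by (auto simp: choice_functions_def unary_type_def formulas_def PiE_iff)

text \<open>Omission becomes a condition on single elements that involves one formula from each
  type, which elementary maps and Los's theorem can carry over.\<close>

lemma omits_iff_witnessed:
  "(\<forall>p\<in>\<Gamma>. omits M p) \<longleftrightarrow> (\<forall>a\<in>Dom M. \<exists>C\<in>choice_functions \<Gamma>. witnessed \<Gamma> M a C)"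
proof safe
  fix a assume om: "\<forall>p\<in>\<Gamma>. omits M p" and a: "a \<in> Dom M"
  \<comment> \<open>Choice functions are extensional, hence the restriction to \<Gamma>.\<close>
  define C where "C = (\<lambda>p\<in>\<Gamma>. SOME \<phi>. \<phi> \<in> p \<and> \<not> sat M [a] \<phi>)"
  have "C p \<in> p \<and> \<not> sat M [a] (C p)" if "p \<in> \<Gamma>" for p
  proof -
    have "\<exists>\<phi>. \<phi> \<in> p \<and> \<not> sat M [a] \<phi>"
      using om a that by (auto simp: omits_def)
    then show ?thesis
      using that someI_ex[of "\<lambda>\<phi>. \<phi> \<in> p \<and> \<not> sat M [a] \<phi>"] by (simp add: C_def)
  qed
  moreover from this have "C \<in> choice_functions \<Gamma>"
    by (auto simp: choice_functions_def C_def)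
  ultimately show "\<exists>C\<in>choice_functions \<Gamma>. witnessed \<Gamma> M a C"
    by (auto simp: witnessed_def)
next
  fix p assume "\<forall>a\<in>Dom M. \<exists>C\<in>choice_functions \<Gamma>. witnessed \<Gamma> M a C" "p \<in> \<Gamma>"
  then show "omits M p"
    unfolding omits_def witnessed_def choice_functions_def
    by (metis PiE_mem sat.simps(3))
qed

lemma elementary_embedding_sat:
  assumes "elementary_embedding L h M N" "\<phi> \<in> formulas L n" "bs \<in> lists (Dom M)" "length bs = n"
  shows "sat M bs \<phi> \<longleftrightarrow> sat N (map h bs) \<phi>"
  using assms by (simp add: elementary_embedding_def)

lemma elementary_embedding_witnessed:
  assumes h: "elementary_embedding L h M N" and types: "\<And>p. p \<in> \<Gamma> \<Longrightarrow> unary_type L p"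
    and C: "C \<in> choice_functions \<Gamma>" and a: "a \<in> Dom M"
  shows "witnessed \<Gamma> M a C \<longleftrightarrow> witnessed \<Gamma> N (h a) C"
proof -
  have "sat M [a] (C p) \<longleftrightarrow> sat N [h a] (C p)" if "p \<in> \<Gamma>" for p
    using elementary_embedding_sat[OF h, of "C p" 1 "[a]"] choice_functions_wf[OF C that types[OF that]] a
    by (simp add: formulas_def)
  then show ?thesis
    by (simp add: witnessed_def)
qed

section \<open>Transfer of witnesses and niceness to the ultrapower\<close>

context ultrapower
begin

text \<open>As \<Gamma> is finite, the conjunction over its types commutes with
  \<open>eventually\<close>.\<close>

lemma witnessed_UP:
  assumes "finite \<Gamma>" "\<And>p. p \<in> \<Gamma> \<Longrightarrow> unary_type L p" "C \<in> choice_functions \<Gamma>" "u \<in> Dom UP"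
  shows "witnessed \<Gamma> UP u C \<longleftrightarrow> (\<forall>\<^sub>F i in F. witnessed \<Gamma> M (u i) C)"
proof -
  have "sat UP [u] (Neg (C p)) \<longleftrightarrow> (\<forall>\<^sub>F i in F. sat M [u i] (Neg (C p)))" if "p \<in> \<Gamma>" for p
    using Los[of 1 "Neg (C p)" "[u]"] choice_functions_wf[of C \<Gamma> p L] assms that by simp
  then show ?thesis
    unfolding witnessed_def using assms(1) by (simp add: eventually_ball_finite_distrib del: sat.simps)
qed

text \<open>The choice function \<open>g Cs\<close> depends on those of the parameters alone, not on
  the index. The witnesses found in M at almost all indices thus share one choice function, which
  then also witnesses the sequence they form.\<close>

lemma nice_UP_witness:
  assumes fin: "finite \<Gamma>" and types: "\<And>p. p \<in> \<Gamma> \<Longrightarrow> unary_type L p" and nice: "nice L \<Gamma> M"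
    and \<phi>: "\<phi> \<in> formulas L (Suc n)" and bs: "length bs = n"
      "\<And>b. b \<in> set bs \<Longrightarrow> b \<in> Dom UP \<and> (\<exists>C\<in>choice_functions \<Gamma>. witnessed \<Gamma> UP b C)"
    and sat: "sat UP bs (Ex \<phi>)"
  shows "\<exists>u\<in>Dom UP. (\<exists>C\<in>choice_functions \<Gamma>. witnessed \<Gamma> UP u C) \<and> sat UP (u # bs) \<phi>"
proof -
  have "\<forall>b\<in>set bs. \<exists>C. C \<in> choice_functions \<Gamma> \<and> witnessed \<Gamma> UP b C"
    using bs(2) by blast
  from bchoice[OF this] obtain c where
    c: "\<forall>b\<in>set bs. c b \<in> choice_functions \<Gamma> \<and> witnessed \<Gamma> UP b (c b)" ..
  define Cs where "Cs = map c bs"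
  have Cs: "Cs \<in> lists (choice_functions \<Gamma>)" "length Cs = n"
    using c bs(1) by (auto simp: Cs_def)
  have dom: "bs \<in> lists (Dom UP)"
    using bs(2) by auto
  from nice[unfolded nice_def, rule_format, OF \<phi>]
  obtain g where g: "g \<in> {Cs \<in> lists (choice_functions \<Gamma>). length Cs = n} \<rightarrow> choice_functions \<Gamma>"
    and gM: "\<forall>Cs\<in>lists (choice_functions \<Gamma>). \<forall>bs\<in>lists (Dom M).
         length Cs = n \<and> length bs = n \<and> (\<forall>i<n. witnessed \<Gamma> M (bs ! i) (Cs ! i)) \<and>
         sat M bs (Ex \<phi>) \<longrightarrow>
         (\<exists>m\<in>Dom M. sat M (m # bs) \<phi> \<and> (\<forall>p\<in>\<Gamma>. sat M [m] (Neg (g Cs p))))" ..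
  have gCs: "g Cs \<in> choice_functions \<Gamma>"
    using g Cs by blast
  have "\<forall>\<^sub>F i in F. \<forall>b\<in>set bs. witnessed \<Gamma> M (b i) (c b)"
    by (rule eventually_ball_finite) (use c bs(2) witnessed_UP[OF fin types] in auto)
  moreover have "\<forall>\<^sub>F i in F. sat M (map (\<lambda>b. b i) bs) (Ex \<phi>)"
    using Los[OF _ dom bs(1), of "Ex \<phi>"] sat \<phi> by (simp add: formulas_def)
  ultimately have "\<forall>\<^sub>F i in F. \<exists>m\<in>Dom M. sat M (m # map (\<lambda>b. b i) bs) \<phi> \<and> witnessed \<Gamma> M m (g Cs)"
  proof eventually_elim
    case (elim i)
    show ?case
      by (rule gM[folded witnessed_def, rule_format, OF Cs(1)])
        (use elim dom bs(1) Cs(2) Dom_UP in \<open>auto simp: Cs_def simp del: sat.simps\<close>)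
  qed
  from UP_choice[OF this] obtain u where u: "u \<in> Dom UP"
    "\<forall>\<^sub>F i in F. sat M (u i # map (\<lambda>b. b i) bs) \<phi> \<and> witnessed \<Gamma> M (u i) (g Cs)" ..
  then have "witnessed \<Gamma> UP u (g Cs)" "sat UP (u # bs) \<phi>"
    using witnessed_UP[OF fin types gCs] Los[of "Suc n" \<phi> "u # bs"] \<phi> bs(1) dom
    by (auto simp: formulas_def eventually_conj_iff)
  then show ?thesis
    using u(1) gCs by blast
qed

end

section \<open>Elementary extensions of prescribed size\<close>

lemma nice_extension:
  fixes M :: "('f, 'r, 'a) struct" and K :: "'c set"
  assumes fin: "finite \<Gamma>" and types: "\<And>p. p \<in> \<Gamma> \<Longrightarrow> unary_type L p"
    and M: "is_structure L M" and omit: "\<forall>p\<in>\<Gamma>. omits M p" and nice: "nice L \<Gamma> M"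
    and C: "C \<in> choice_functions \<Gamma>" and inf: "infinite {a \<in> Dom M. witnessed \<Gamma> M a C}"
    and K: "infinite K" "Dom M \<lesssim> K" "Funs L <+> Rels L \<lesssim> K"
  shows "\<exists>N :: ('f, 'r, 'a + 'c) struct.
    elementary_extension L M N \<and> (\<forall>p\<in>\<Gamma>. omits N p) \<and> Dom N \<approx> K"
proof -
  \<comment> \<open>Almost every index is a finite subset of K, and each given element of K belongs
    to almost every index.\<close>
  obtain F where F: "F \<le> finite_subsets_at_top K" "ultrafilter F"
    using ultrafilter_exists by (metis finite_subsets_at_top_neq_bot)
  interpret ultrapower L M F
    using M F by unfold_locales
  obtain f :: "nat \<Rightarrow> 'a" where f: "inj f" "range f \<subseteq> {a \<in> Dom M. witnessed \<Gamma> M a C}"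
    using infinite_countable_subset[OF inf] by blast
  \<comment> \<open>\<open>to_nat_on\<close> numbers each finite i injectively, so f separates the
    elements of i. In this way a countable sequence in M yields |K| distinct elements of the
    ultrapower.\<close>
  define c where "c k = cls (\<lambda>i. f (to_nat_on i k))" for k
  have seq: "(\<lambda>i. f (to_nat_on i k)) \<in> seqs" for k
    using f(2) by (auto simp: seqs_def)
  have c: "c k \<in> Dom UP" "\<forall>\<^sub>F i in F. c k i = f (to_nat_on i k)" for k
    using cls(2)[OF seq] seq by (auto simp: c_def UP_def)
  have c_wit: "witnessed \<Gamma> UP (c k) C" for k
  proof -
    have "\<forall>\<^sub>F i in F. witnessed \<Gamma> M (c k i) C"
      using c(2)[of k] by eventually_elim (use f(2) in auto)
    then show ?thesis
      using witnessed_UP[OF fin types C c(1)] by simp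
  qed
  have c_inj: "inj_on c K"
  proof (rule inj_onI, rule ccontr)
    fix k l assume kl: "k \<in> K" "l \<in> K" "c k = c l" "k \<noteq> l"
    have "\<forall>\<^sub>F i in finite_subsets_at_top K. finite i \<and> k \<in> i \<and> l \<in> i"
      unfolding eventually_finite_subsets_at_top using kl by (intro exI[of _ "{k, l}"]) auto
    then have "\<forall>\<^sub>F i in F. finite i \<and> k \<in> i \<and> l \<in> i"
      using F(1) by (simp add: filter_leD)
    then have "\<forall>\<^sub>F i in F. False"
      using c(2)[of k] c(2)[of l]
    proof eventually_elim
      case (elim i)
      then have "to_nat_on i k = to_nat_on i l"
        using f(1) kl(3) by (simp add: inj_eq)
      then show False
        using elim kl(4) inj_on_to_nat_on[of i] by (auto simp: countable_finite inj_on_eq_iff)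
    qed
    then show False
      using F(2) by (simp add: ultrafilter_def)
  qed
  \<comment> \<open>The ultrapower itself may realize types of \<Gamma>; H keeps the elements that
    realize none.\<close>
  define H where "H = {u \<in> Dom UP. \<exists>C\<in>choice_functions \<Gamma>. witnessed \<Gamma> UP u C}"
  have diagH: "diag a \<in> H" if "a \<in> Dom M" for a
    using that omit diag(1) elementary_embedding_witnessed[OF elementary_embedding_diag types]
    by (auto simp: H_def omits_iff_witnessed)
  have cH: "c k \<in> H" for k
    using c c_wit C by (auto simp: H_def)
  \<comment> \<open>These are Skolem functions with values in H; where H has no witness, an
    arbitrary element of H is returned.\<close>
  define g where "g \<phi> bs = (if \<exists>m\<in>H. sat UP (m # bs) \<phi> then SOME m. m \<in> H \<and> sat UP (m # bs) \<phi>
    else c undefined)" for \<phi> bs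
  have g: "g \<phi> bs \<in> H" "m \<in> H \<Longrightarrow> sat UP (m # bs) \<phi> \<Longrightarrow> sat UP (g \<phi> bs # bs) \<phi>" for \<phi> bs m
    using someI_ex[of "\<lambda>m. m \<in> H \<and> sat UP (m # bs) \<phi>"] cH by (auto simp: g_def)
  \<comment> \<open>The diagonal copy of M makes the hull extend M, and the elements
    \<open>c k\<close> make it at least as large as K.\<close>
  define B where "B = diag ` Dom M \<union> c ` K"
  define E where "E = generated B {\<phi>. \<exists>n. wf_fm L n \<phi>} g"
  have B: "B \<subseteq> E"
    by (auto simp: E_def intro: generated.base)
  have EH: "E \<subseteq> H"
  proof
    fix u assume "u \<in> E"
    then show "u \<in> H"
      unfolding E_def by cases (use diagH cH g(1) in \<open>auto simp: B_def\<close>)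
  qed
  have "B \<lesssim> K"
    unfolding B_def by (intro infinite_Un_lepoll K lepoll_trans[OF image_lepoll] lepoll_refl)
  then have E_K: "E \<lesssim> K"
    unfolding E_def by (intro generated_lepoll K wf_fms_lepoll)
  have K_E: "K \<lesssim> E"
    unfolding lepoll_def using c_inj B by (auto simp: B_def intro!: exI[of _ c])
  have E_sub: "E \<subseteq> Dom UP" "E \<noteq> {}"
    using EH B K(1) by (auto simp: H_def B_def)
  have test: "\<exists>m\<in>E. sat UP (m # bs) \<phi>"
    if "\<phi> \<in> formulas L (Suc n)" "bs \<in> lists E" "length bs = n" "sat UP bs (Ex \<phi>)" for n \<phi> bs
  proof -
    have "b \<in> Dom UP \<and> (\<exists>C\<in>choice_functions \<Gamma>. witnessed \<Gamma> UP b C)" if "b \<in> set bs" for b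
      using that \<open>bs \<in> lists E\<close> EH by (auto simp: H_def)
    then have "\<exists>m\<in>H. sat UP (m # bs) \<phi>"
      using nice_UP_witness[OF fin types nice that(1) that(3) _ that(4)] unfolding H_def by blast
    then have "sat UP (g \<phi> bs # bs) \<phi>"
      using g(2) by blast
    moreover have "g \<phi> bs \<in> E"
      unfolding E_def by (rule generated.step) (use that in \<open>auto simp: formulas_def E_def\<close>)
    ultimately show ?thesis by blast
  qed
  define V where "V = UP\<lparr>Dom := E\<rparr>"
  have V: "is_structure L V" "elementary_embedding L (\<lambda>x. x) V UP"
    unfolding V_def using tarski_vaught[OF struct_UP E_sub test] by auto
  have Dom_V: "Dom V = E"
    by (simp add: V_def)
  obtain \<iota> where \<iota>: "inj_on \<iota> E" "\<iota> ` E \<subseteq> K"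
    using E_K by (auto simp: lepoll_def)
  \<comment> \<open>The hull is renamed so that M appears under \<open>Inl\<close>; the remaining
    elements are sent to \<open>Inr\<close> by an injection into K.\<close>
  define j where
    "j u = (if u \<in> diag ` Dom M then Inl (inv_into (Dom M) diag u) else Inr (\<iota> u))" for u
  have j_inj: "inj_on j E"
    using \<iota>(1) by (intro inj_onI) (auto simp: j_def inj_on_eq_iff inj_diag split: if_splits)
  have j_diag: "j (diag a) = Inl a" if "a \<in> Dom M" for a
    using that by (simp add: j_def inj_diag)
  define N where "N = image_struct j V"
  have N: "is_structure L N" "elementary_embedding L j V N"
    unfolding N_def by (rule image_struct; use V j_inj Dom_V in simp)+
  have Dom_N: "Dom N = j ` E"
    by (simp add: N_def image_struct_def Dom_V)
  have diagE: "diag a \<in> E" if "a \<in> Dom M" for a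
    using that B by (auto simp: B_def)
  have "elementary_embedding L Inl M N"
    unfolding elementary_embedding_def
  proof (intro conjI allI ballI impI)
    show "Inl ` Dom M \<subseteq> Dom N"
      using diagE j_diag by (force simp: Dom_N)
    fix n \<phi> bs assume \<phi>: "\<phi> \<in> formulas L n" and bs: "bs \<in> lists (Dom M)" "length bs = n"
    have "sat M bs \<phi> \<longleftrightarrow> sat UP (map diag bs) \<phi>"
      using elementary_embedding_sat[OF elementary_embedding_diag \<phi> bs] .
    also have "\<dots> \<longleftrightarrow> sat V (map diag bs) \<phi>"
    proof -
      have "map diag bs \<in> lists (Dom V)"
        using bs diagE by (auto simp: Dom_V)
      then show ?thesis
        using elementary_embedding_sat[OF V(2) \<phi>, of "map diag bs"] bs by simp
    qed
    also have "\<dots> \<longleftrightarrow> sat N (map j (map diag bs)) \<phi>"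
      by (rule elementary_embedding_sat[OF N(2) \<phi>]) (use bs diagE in \<open>auto simp: Dom_V\<close>)
    also have "map j (map diag bs) = map Inl bs"
      using bs j_diag by auto
    finally show "sat M bs \<phi> \<longleftrightarrow> sat N (map Inl bs) \<phi>" .
  qed
  moreover have "\<exists>C\<in>choice_functions \<Gamma>. witnessed \<Gamma> N (j u) C" if "u \<in> E" for u
    using that EH elementary_embedding_witnessed[OF V(2) types, where a = u]
      elementary_embedding_witnessed[OF N(2) types, where a = u]
    by (auto simp: Dom_V H_def)
  then have "\<forall>p\<in>\<Gamma>. omits N p"
    unfolding omits_iff_witnessed by (auto simp: Dom_N)
  moreover have "Dom N \<approx> K"
    using inj_on_image_eqpoll_self[OF j_inj] E_K K_E lepoll_antisym eqpoll_trans
    by (metis Dom_N)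
  ultimately show ?thesis
    using N(1) by (auto simp: elementary_extension_def)
qed

subsection \<open>Back and forth\<close>

text \<open>The empty conjunction is an equation of variable 0 with itself, so at least one variable
  must be in scope.\<close>

definition conjs :: "('f, 'r) fm list \<Rightarrow> ('f, 'r) fm" where
  "conjs \<phi>s = foldr Conj \<phi>s (Eq (Var 0) (Var 0))"

lemma sat_conjs: "sat M bs (conjs \<phi>s) \<longleftrightarrow> (\<forall>\<phi>\<in>set \<phi>s. sat M bs \<phi>)"
  by (induction \<phi>s) (auto simp: conjs_def)

lemma conjs_wf: "\<forall>\<phi>\<in>set \<phi>s. wf_fm L (Suc n) \<phi> \<Longrightarrow> wf_fm L (Suc n) (conjs \<phi>s)"
  by (induction \<phi>s) (auto simp: conjs_def)

text \<open>This is a finite partial elementary map, given by its list of arguments and its list of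
  values. The empty map is elementary equivalence, and prepending a pair matches the index that
  \<open>Ex\<close> binds.\<close>

definition same_type ::
    "('f, 'r) language \<Rightarrow> ('f, 'r, 'a) struct \<Rightarrow> 'a list \<Rightarrow> ('f, 'r, 'b) struct \<Rightarrow> 'b list \<Rightarrow> bool" where
  "same_type L X xs Y ys \<longleftrightarrow> length xs = length ys \<and>
     (\<forall>\<phi>\<in>formulas L (length xs). sat X xs \<phi> \<longleftrightarrow> sat Y ys \<phi>)"

lemma same_type_sat:
  "same_type L X xs Y ys \<Longrightarrow> wf_fm L (length xs) \<phi> \<Longrightarrow> sat X xs \<phi> \<longleftrightarrow> sat Y ys \<phi>"
  by (auto simp: same_type_def formulas_def)

lemma same_type_nth_eq_iff:
  assumes "same_type L X xs Y ys" "i < length xs" "k < length xs"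
  shows "xs ! i = xs ! k \<longleftrightarrow> ys ! i = ys ! k"
  using same_type_sat[OF assms(1), of "Eq (Var i) (Var k)"] assms by simp

lemma sat_Cons_unary: "wf_fm L 1 \<phi> \<Longrightarrow> sat M (a # as) \<phi> \<longleftrightarrow> sat M [a] \<phi>"
  by (rule sat_cong[of L 1]) auto

lemma wf_tm_mono: "wf_tm L n t \<Longrightarrow> n \<le> m \<Longrightarrow> wf_tm L m t"
  by (induction t) (auto simp: list_all_iff)

lemma wf_fm_mono: "wf_fm L n \<phi> \<Longrightarrow> n \<le> m \<Longrightarrow> wf_fm L m \<phi>"
  by (induction \<phi> arbitrary: n m) (auto simp: list_all_iff dest: wf_tm_mono)

text \<open>The head has index 0, so a unary formula evaluated at the whole list speaks about the
  head alone.\<close>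

lemma same_type_hd_witnessed:
  assumes "same_type L X (x # xs) Y (y # ys)" "C \<in> choice_functions \<Gamma>"
    and types: "\<And>p. p \<in> \<Gamma> \<Longrightarrow> unary_type L p"
  shows "witnessed \<Gamma> X x C \<longleftrightarrow> witnessed \<Gamma> Y y C"
proof -
  have "sat X [x] (C p) \<longleftrightarrow> sat Y [y] (C p)" if "p \<in> \<Gamma>" for p
  proof -
    have wf: "wf_fm L 1 (C p)"
      using choice_functions_wf assms that by blast
    then have "sat X (x # xs) (C p) \<longleftrightarrow> sat Y (y # ys) (C p)"
      by (intro same_type_sat[OF assms(1)] wf_fm_mono[OF wf]) simp
    then show ?thesis
      using sat_Cons_unary[OF wf] by metis
  qed
  then show ?thesis
    by (simp add: witnessed_def)
qed

text \<open>Finiteness stands in for saturation: one formula per candidate in D refutes them all.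
  The formulas \<open>Neg (C p)\<close> are added to the conjunction so that any realization in Y
  must lie in D.\<close>

lemma same_type_extend:
  assumes fin: "finite \<Gamma>" and types: "\<And>p. p \<in> \<Gamma> \<Longrightarrow> unary_type L p"
    and C: "C \<in> choice_functions \<Gamma>" and finY: "finite {b \<in> Dom Y. witnessed \<Gamma> Y b C}"
    and st: "same_type L X xs Y ys" and x: "x \<in> Dom X" "witnessed \<Gamma> X x C"
  shows "\<exists>y\<in>Dom Y. same_type L X (x # xs) Y (y # ys)"
proof (rule ccontr)
  define D where "D = {b \<in> Dom Y. witnessed \<Gamma> Y b C}"
  let ?n = "length xs"
  have len: "length ys = ?n"
    using st by (simp add: same_type_def)
  assume *: "\<not> ?thesis"
  have "\<forall>y\<in>D. \<exists>\<phi>. wf_fm L (Suc ?n) \<phi> \<and> sat X (x # xs) \<phi> \<and> \<not> sat Y (y # ys) \<phi>"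
  proof
    fix y assume "y \<in> D"
    then obtain \<phi> where \<phi>: "wf_fm L (Suc ?n) \<phi>" "sat X (x # xs) \<phi> \<noteq> sat Y (y # ys) \<phi>"
      using * len by (auto simp: D_def same_type_def formulas_def)
    \<comment> \<open>Passing to the negation if necessary, the distinguishing formula holds on the
      side of X.\<close>
    show "\<exists>\<phi>. wf_fm L (Suc ?n) \<phi> \<and> sat X (x # xs) \<phi> \<and> \<not> sat Y (y # ys) \<phi>"
    proof (cases "sat X (x # xs) \<phi>")
      case True
      then show ?thesis using \<phi> by blast
    next
      case False
      then show ?thesis using \<phi> by (intro exI[of _ "Neg \<phi>"]) auto
    qed
  qed
  from bchoice[OF this] obtain \<psi> where
    \<psi>: "\<forall>y\<in>D. wf_fm L (Suc ?n) (\<psi> y) \<and> sat X (x # xs) (\<psi> y) \<and> \<not> sat Y (y # ys) (\<psi> y)" ..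
  have wfC: "wf_fm L 1 (Neg (C p))" if "p \<in> \<Gamma>" for p
    using choice_functions_wf[OF C that types[OF that]] by simp
  obtain \<phi>s where \<phi>s: "set \<phi>s = \<psi> ` D \<union> (\<lambda>p. Neg (C p)) ` \<Gamma>"
    using finite_list[of "\<psi> ` D \<union> (\<lambda>p. Neg (C p)) ` \<Gamma>"] fin finY by (auto simp: D_def)
  have "\<forall>\<phi>\<in>set \<phi>s. wf_fm L (Suc ?n) \<phi>"
    unfolding \<phi>s using \<psi> wf_fm_mono[OF wfC, of _ "Suc ?n"] by (auto simp del: wf_fm.simps)
  then have wf: "wf_fm L (Suc ?n) (conjs \<phi>s)"
    by (rule conjs_wf)
  have "sat X (x # xs) (conjs \<phi>s)"
    unfolding sat_conjs \<phi>s using \<psi> x(2) sat_Cons_unary[OF wfC, of _ X x xs]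
    by (auto simp: witnessed_def)
  then have "sat X xs (Ex (conjs \<phi>s))"
    using x by auto
  then have "sat Y ys (Ex (conjs \<phi>s))"
    using same_type_sat[OF st, of "Ex (conjs \<phi>s)"] wf by simp
  then obtain y where y: "y \<in> Dom Y" "sat Y (y # ys) (conjs \<phi>s)"
    by auto
  then have "\<forall>p\<in>\<Gamma>. sat Y (y # ys) (Neg (C p))"
    unfolding sat_conjs \<phi>s by blast
  then have "y \<in> D"
    using sat_Cons_unary[OF wfC, of _ Y y ys] y(1) by (simp add: D_def witnessed_def)
  then show False
    using y \<psi> by (auto simp: sat_conjs \<phi>s)
qed

lemma elementarily_equivalent_iff_same_type:
  "elementarily_equivalent L X Y \<longleftrightarrow> same_type L X [] Y []"
  by (simp add: elementarily_equivalent_def same_type_def)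

text \<open>Extending the empty map step by step carries any finite set of elements witnessed by C
  in X injectively to such elements of Y. A common bound on all finite subsets bounds the whole
  set.\<close>

lemma witnessed_card_le:
  assumes fin: "finite \<Gamma>" and types: "\<And>p. p \<in> \<Gamma> \<Longrightarrow> unary_type L p"
    and C: "C \<in> choice_functions \<Gamma>" and finY: "finite {b \<in> Dom Y. witnessed \<Gamma> Y b C}"
    and eq: "elementarily_equivalent L X Y"
  shows "finite {a \<in> Dom X. witnessed \<Gamma> X a C}"
    and "card {a \<in> Dom X. witnessed \<Gamma> X a C} \<le> card {b \<in> Dom Y. witnessed \<Gamma> Y b C}"
proof -
  let ?DX = "{a \<in> Dom X. witnessed \<Gamma> X a C}" and ?DY = "{b \<in> Dom Y. witnessed \<Gamma> Y b C}"
  have lists: "\<exists>ys. set ys \<subseteq> ?DY \<and> same_type L X xs Y ys" if "set xs \<subseteq> ?DX" for xs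
    using that
  proof (induction xs)
    case Nil
    then show ?case
      using eq by (intro exI[of _ "[]"]) (simp add: elementarily_equivalent_iff_same_type)
  next
    case (Cons x xs)
    then obtain ys where ys: "set ys \<subseteq> ?DY" "same_type L X xs Y ys"
      by auto
    then obtain y where "y \<in> Dom Y" "same_type L X (x # xs) Y (y # ys)"
      using same_type_extend[OF fin types C finY ys(2), of x] Cons.prems by auto
    moreover from this have "witnessed \<Gamma> Y y C"
      using same_type_hd_witnessed[OF _ C types] Cons.prems
      by (metis (mono_tags, lifting) insert_subset list.set(2) mem_Collect_eq)
    ultimately show ?case
      using ys(1) by (intro exI[of _ "y # ys"]) auto
  qed
  have "card S \<le> card ?DY" if S: "finite S" "S \<subseteq> ?DX" for S
  proof -
    obtain xs where xs: "set xs = S" "distinct xs"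
      using finite_distinct_list[OF S(1)] by blast
    then obtain ys where ys: "set ys \<subseteq> ?DY" "same_type L X xs Y ys"
      using lists S(2) by blast
    have len: "length ys = length xs"
      using ys(2) by (simp add: same_type_def)
    have "distinct ys"
      using xs(2) same_type_nth_eq_iff[OF ys(2)] len by (simp add: distinct_conv_nth)
    then have "card S = card (set ys)"
      using xs len distinct_card by metis
    also have "\<dots> \<le> card ?DY"
      by (rule card_mono[OF finY ys(1)])
    finally show ?thesis .
  qed
  then show "finite ?DX" "card ?DX \<le> card ?DY"
    using finite_if_finite_subsets_card_bdd[of ?DX "card ?DY"] by auto
qed

text \<open>Only the forth half of a back-and-forth argument is carried out, along an enumeration of
  N; counting for each choice function replaces the back half.\<close>

lemma isomorphic_if_witnessed_finite:
  fixes N :: "('f, 'r, 'b) struct" and M :: "('f, 'r, 'a) struct"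
  assumes fin: "finite \<Gamma>" and types: "\<And>p. p \<in> \<Gamma> \<Longrightarrow> unary_type L p"
    and ctbl: "\<And>p. p \<in> \<Gamma> \<Longrightarrow> countable p"
    and M: "is_structure L M" "\<forall>p\<in>\<Gamma>. omits M p"
    and N: "is_structure L N" "\<forall>p\<in>\<Gamma>. omits N p"
    and eq: "elementarily_equivalent L N M"
    and finM: "\<And>C. C \<in> choice_functions \<Gamma> \<Longrightarrow> finite {a \<in> Dom M. witnessed \<Gamma> M a C}"
  shows "isomorphic L N M"
proof -
  let ?DM = "\<lambda>C. {a \<in> Dom M. witnessed \<Gamma> M a C}" and ?DN = "\<lambda>C. {b \<in> Dom N. witnessed \<Gamma> N b C}"
  have eq': "elementarily_equivalent L M N"
    using eq by (simp add: elementarily_equivalent_def)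
  have finN: "finite (?DN C)" and card: "card (?DN C) = card (?DM C)"
    if "C \<in> choice_functions \<Gamma>" for C
  proof -
    show "finite (?DN C)"
      using witnessed_card_le[OF fin types that finM[OF that] eq] by simp
    from witnessed_card_le(2)[OF fin types that this eq']
      witnessed_card_le(2)[OF fin types that finM[OF that] eq]
    show "card (?DN C) = card (?DM C)" by simp
  qed
  \<comment> \<open>\<Gamma> is finite and its types are countable, so N is a countable union of
    finite sets.\<close>
  have "countable (choice_functions \<Gamma>)"
    unfolding choice_functions_def using fin ctbl by (intro countable_PiE) auto
  then have "countable (\<Union>C\<in>choice_functions \<Gamma>. ?DN C)"
    using finN by (auto intro: countable_finite)
  moreover have "Dom N \<subseteq> (\<Union>C\<in>choice_functions \<Gamma>. ?DN C)"
    using N(2) by (auto simp: omits_iff_witnessed)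
  ultimately have "countable (Dom N)"
    by (rule countable_subset[rotated])
  moreover have "Dom N \<noteq> {}"
    using N(1) by (simp add: is_structure_def)
  \<comment> \<open>The enumeration may repeat elements, which also covers finite N.\<close>
  ultimately obtain e :: "nat \<Rightarrow> 'b" where e: "range e = Dom N"
    by (metis range_from_nat_into)
  \<comment> \<open>The newest element comes first, to agree with de Bruijn indices; hence
    \<open>e i\<close> stands at position \<open>n - Suc i\<close> of \<open>E n\<close>.\<close>
  define E where "E n = map e (rev [0..<n])" for n
  have E_Suc: "E (Suc n) = e n # E n" for n
    by (simp add: E_def)
  \<comment> \<open>Each list of values must extend the previous one, so that all of them are
    initial parts of one sequence y.\<close>
  have "\<exists>Y. \<forall>n. (set (Y n) \<subseteq> Dom M \<and> same_type L N (E n) M (Y n)) \<and> (\<exists>y. Y (Suc n) = y # Y n)"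
  proof (rule dependent_nat_choice)
    show "\<exists>ys. set ys \<subseteq> Dom M \<and> same_type L N (E 0) M ys"
      using eq by (intro exI[of _ "[]"]) (simp add: E_def elementarily_equivalent_iff_same_type)
  next
    fix ys n assume ys: "set ys \<subseteq> Dom M \<and> same_type L N (E n) M ys"
    have en: "e n \<in> Dom N"
      using e by blast
    then obtain C where C: "C \<in> choice_functions \<Gamma>" "witnessed \<Gamma> N (e n) C"
      using N(2) unfolding omits_iff_witnessed by blast
    obtain y where "y \<in> Dom M" "same_type L N (e n # E n) M (y # ys)"
      using same_type_extend[OF fin types C(1) finM[OF C(1)] ys[THEN conjunct2] en C(2)] ..
    then show "\<exists>zs. (set zs \<subseteq> Dom M \<and> same_type L N (E (Suc n)) M zs) \<and> (\<exists>y. zs = y # ys)"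
      using ys by (intro exI[of _ "y # ys"]) (auto simp: E_Suc)
  qed
  then obtain Y where Y: "\<And>n. set (Y n) \<subseteq> Dom M" "\<And>n. same_type L N (E n) M (Y n)"
    "\<And>n. \<exists>y. Y (Suc n) = y # Y n"
    by blast
  define y where "y n = hd (Y (Suc n))" for n
  have Y_Suc: "Y (Suc n) = y n # Y n" for n
    using Y(3)[of n] by (auto simp: y_def)
  have "Y n = map y (rev [0..<n])" for n
  proof (induction n)
    case 0
    then show ?case using Y(2)[of 0] by (simp add: same_type_def E_def)
  qed (simp add: Y_Suc)
  note Y_eq = this
  have nth: "E n ! (n - Suc i) = e i" "Y n ! (n - Suc i) = y i" if "i < n" for i n
    using that by (simp_all add: E_def Y_eq rev_nth)
  have len: "length (E n) = n" for n
    by (simp add: E_def)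
  have y_eq_iff: "e i = e k \<longleftrightarrow> y i = y k" for i k
    using same_type_nth_eq_iff[OF Y(2)[of "Suc (i + k)"], of k i]
      nth[of i "Suc (i + k)"] nth[of k "Suc (i + k)"] by (simp add: len)
  \<comment> \<open>Any index of b serves, since by \<open>y_eq_iff\<close> the value
    \<open>y i\<close> depends on \<open>e i\<close> only.\<close>
  define h where "h b = y (SOME i. e i = b)" for b
  have h_e: "h (e i) = y i" for i
    using someI[of "\<lambda>k. e k = e i" i] y_eq_iff unfolding h_def by blast
  have h_inj: "inj_on h (Dom N)"
    unfolding e[symmetric] using y_eq_iff by (auto simp: inj_on_def h_e)
  have y_wit: "witnessed \<Gamma> N (e i) C \<longleftrightarrow> witnessed \<Gamma> M (y i) C" if "C \<in> choice_functions \<Gamma>" for i C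
    using same_type_hd_witnessed[OF _ that types] Y(2)[of "Suc i"] by (simp add: E_Suc Y_Suc)
  have y_Dom: "y i \<in> Dom M" for i
    using Y(1)[of "Suc i"] by (simp add: Y_Suc)
  have h_Dom: "h ` Dom N = Dom M"
  proof
    show "h ` Dom N \<subseteq> Dom M"
      unfolding e[symmetric] using y_Dom by (auto simp: h_e)
    show "Dom M \<subseteq> h ` Dom N"
    proof
      fix m assume "m \<in> Dom M"
      then obtain C where C: "C \<in> choice_functions \<Gamma>" "m \<in> ?DM C"
        using M(2) unfolding omits_iff_witnessed by blast
      \<comment> \<open>An injection between finite sets of equal size is onto, so m is
        reached.\<close>
      have "h ` ?DN C \<subseteq> ?DM C"
      proof
        fix a assume "a \<in> h ` ?DN C"
        then obtain b where b: "a = h b" "b \<in> Dom N" "witnessed \<Gamma> N b C"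
          by blast
        then obtain i where "b = e i"
          using e by blast
        with b show "a \<in> ?DM C"
          using y_wit[OF C(1)] y_Dom by (simp add: h_e)
      qed
      moreover have "card (h ` ?DN C) = card (?DM C)"
        using card[OF C(1)] by (subst card_image) (auto intro: inj_on_subset[OF h_inj])
      ultimately have "h ` ?DN C = ?DM C"
        using finM[OF C(1)] card_subset_eq by blast
      then show "m \<in> h ` Dom N"
        using C(2) by blast
    qed
  qed
  have atomic: "sat N (E n) \<phi> \<longleftrightarrow> sat M (Y n) \<phi>" if "wf_fm L n \<phi>" for n \<phi>
    using same_type_sat[OF Y(2), of n \<phi>] that by (simp add: len)
  have index: "\<exists>is n. as = map e is \<and> (\<forall>i\<in>set is. i < n)" if "as \<in> lists (Dom N)" for as
  proof -
    have "as \<in> lists (range e)"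
      using that e by simp
    then obtain "is" where "as = map e is"
      by (auto simp: lists_image)
    moreover have "\<forall>i\<in>set is. i < Suc (Max (set is))"
      by (simp add: less_Suc_eq_le)
    ultimately show ?thesis by blast
  qed
  have vars: "map (eval N (E n)) (map (\<lambda>i. Var (n - Suc i)) is) = map e is"
    "map (eval M (Y n)) (map (\<lambda>i. Var (n - Suc i)) is) = map y is" if "\<forall>i\<in>set is. i < n" for "is" n
    using that by (simp_all add: nth)
  have h_fun: "h (fun_int N f as) = fun_int M f (map h as)"
    if f: "f \<in> Funs L" and as: "as \<in> lists (Dom N)" "length as = fun_arity L f" for f as
  proof -
    have "fun_int N f as \<in> Dom N"
      using N(1) f as by (simp add: is_structure_def)
    \<comment> \<open>The value is indexed along with the arguments, so that one equation about a
      finite part of the enumeration expresses the action of f.\<close>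
    then have "fun_int N f as # as \<in> lists (Dom N)"
      using as by simp
    from index[OF this] obtain "is" n
      where "fun_int N f as # as = map e is" and n: "\<forall>i\<in>set is. i < n"
      by (elim exE conjE)
    then obtain k ks where ks: "is = k # ks" "fun_int N f as = e k" "as = map e ks"
      by (auto simp: Cons_eq_map_conv)
    define ts :: "'f tm list" where "ts = map (\<lambda>i. Var (n - Suc i)) ks"
    have "sat N (E n) (Eq (Var (n - Suc k)) (App f ts))
        \<longleftrightarrow> sat M (Y n) (Eq (Var (n - Suc k)) (App f ts))"
      by (rule atomic) (use ks n f as in \<open>auto simp: ts_def list_all_iff\<close>)
    then have "y k = fun_int M f (map y ks)"
      using vars[of ks n] nth[of k n] ks n by (simp add: ts_def del: map_map)
    then show ?thesis
      using ks by (simp add: h_e comp_def)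
  qed
  have h_rel: "rel_int N r as \<longleftrightarrow> rel_int M r (map h as)"
    if r: "r \<in> Rels L" and as: "as \<in> lists (Dom N)" "length as = rel_arity L r" for r as
  proof -
    from index[OF as(1)] obtain ks n where ks: "as = map e ks" and n: "\<forall>i\<in>set ks. i < n"
      by (elim exE conjE)
    define ts :: "'f tm list" where "ts = map (\<lambda>i. Var (n - Suc i)) ks"
    have "sat N (E n) (Rel r ts) \<longleftrightarrow> sat M (Y n) (Rel r ts)"
      by (rule atomic) (use ks n r as in \<open>auto simp: ts_def list_all_iff\<close>)
    then have "rel_int N r (map e ks) \<longleftrightarrow> rel_int M r (map y ks)"
      using vars[OF n] by (simp add: ts_def del: map_map)
    then show ?thesis
      using ks by (simp add: h_e comp_def)
  qed
  show ?thesis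
    unfolding isomorphic_def bij_betw_def
    by (intro exI[of _ h] conjI ballI impI h_inj h_Dom h_fun h_rel)
qed

section \<open>The dichotomy\<close>

theorem theorem3p13:
  fixes L :: "('f, 'r) language"
    and \<Gamma> :: "('f, 'r) fm set set"
    and M :: "('f, 'r, 'a) struct"
  assumes "finite \<Gamma>"
    and "\<And>p. p \<in> \<Gamma> \<Longrightarrow> unary_type L p \<and> countable p"
    and "is_structure L M"
    and "\<And>p. p \<in> \<Gamma> \<Longrightarrow> omits M p"
    and "nice L \<Gamma> M"
  shows "(\<forall>N :: ('f, 'r, 'b) struct.
            is_structure L N \<and> (\<forall>p\<in>\<Gamma>. omits N p) \<and> elementarily_equivalent L N M
            \<longrightarrow> isomorphic L N M)
       \<or> (\<forall>K :: 'c set.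
            infinite K \<and> Dom M \<lesssim> K \<and> Funs L <+> Rels L \<lesssim> K
            \<longrightarrow> (\<exists>N :: ('f, 'r, 'a + 'c) struct.
                   elementary_extension L M N \<and> (\<forall>p\<in>\<Gamma>. omits N p) \<and> Dom N \<approx> K))"
proof (cases "\<forall>C\<in>choice_functions \<Gamma>. finite {a \<in> Dom M. witnessed \<Gamma> M a C}")
  \<comment> \<open>The case distinction concerns M alone, so the choice of disjunct does not depend
    on the types \<open>'b\<close> and \<open>'c\<close>.\<close>
  case True
  then have "isomorphic L N M"
    if "is_structure L N" "\<forall>p\<in>\<Gamma>. omits N p" "elementarily_equivalent L N M"
    for N :: "('f, 'r, 'b) struct"
    by (intro isomorphic_if_witnessed_finite[of \<Gamma>]) (use assms that in auto)
  then show ?thesis by blast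
next
  case False
  then obtain C where "C \<in> choice_functions \<Gamma>" "infinite {a \<in> Dom M. witnessed \<Gamma> M a C}"
    by blast
  then have "\<exists>N :: ('f, 'r, 'a + 'c) struct.
      elementary_extension L M N \<and> (\<forall>p\<in>\<Gamma>. omits N p) \<and> Dom N \<approx> K"
    if "infinite K" "Dom M \<lesssim> K" "Funs L <+> Rels L \<lesssim> K" for K :: "'c set"
    by (intro nice_extension[of \<Gamma> L M C K]) (use assms that in auto)
  then show ?thesis by blast
qed

end
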